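(* Let $G = (N, \Sigma, \mathcal{I}, \mathcal{A}, S, \phi)$ be a probabilistic Tree Adjoining Grammar satisfying the standing assumptions listed in the context, and let $\mathcal{M}$ be its stochastic expectation matrix. If the spectral radius of $\mathcal{M}$ satisfies $\rho(\mathcal{M}) < 1$, then $G$ is consistent, i.e. $\sum_{v \in L(G)} \Pr(v) = 1$.
   Context: **Probabilistic TAG.** A probabilistic Tree Adjoining Grammar (TAG) is a tuple $G=(N,\Sigma,\mathcal{I},\mathcal{A},S,\phi)$, where $N$ and $\Sigma$ are finite sets of non-terminal and terminal symbols, $S\in N$ is the start symbol, and $\mathcal{I}$ (initial trees) and $\mathcal{A}$ (auxiliary trees) are finite sets of finite ordered node-labelled trees, called elementary trees. Nodes of distinct elementary trees are regarded as distinct. Internal nodes are labelled by elements of $N$ and leaves by elements of $\Sigma\cup\{\epsilon\}$ ($\epsilon$ the empty string), except that each auxiliary tree has one distinguished leaf, its foot node, labelled by the same non-terminal as its root. **Adjunction.** Adjoining an auxiliary tree $t$ at a node $X$ whose label equals the root label of $t$ means: remove the subtree rooted at $X$, put $t$ in its place, and attach the removed subtree at the foot node of $t$. For a node $X$, $\mathrm{Adj}(X)\subseteq\mathcal{A}$ denotes the set of auxiliary trees that can be adjoined at $X$. Write $X\mapsto t$ for the adjunction of $t$ at $X$, and $X\mapsto nil$ for no adjunction at $X$. Let $V=\{X_1,\dots,X_k\}$ be the set of all nodes of all trees in $\mathcal{I}\cup\mathcal{A}$ at which adjunction can occur. The function $\phi$ assigns to each $X\mapsto t$ ($X\in V$,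 $t\in\mathrm{Adj}(X)\cup\{nil\}$) a probability in $[0,1]$; set $\phi(X\mapsto t)=0$ if $t\in(\mathcal{I}\cup\mathcal{A})\setminus\mathrm{Adj}(X)$. **Standing assumptions on $G$.** 1. $G$ is lexicalized: each elementary tree has at least one leaf labelled by an element of $\Sigma$. 2. $G$ is proper: $\phi(X\mapsto nil)+\sum_{t}\phi(X\mapsto t)=1$ for each $X\in V$. 3. Adjunction is prohibited at the foot node of every auxiliary tree. 4. There is a distinguished non-lexicalized start tree $\tau$ (not counted in $\mathcal{I}\cup\mathcal{A}$ and exempt from assumption 1) into which exactly one initial tree with root labelled $S$ is substituted to start a derivation. The initial tree is chosen according to a probability distribution on the initial trees with root label $S$. **Derivations and string probabilities.** A derivation is generated level by level. Level $0$ consists of the initial tree chosen for $\tau$. For each elementary tree occurring at level $i$ and each node $X\in V$ of that tree, independently of everything else, either an auxiliary tree $t\in\mathrm{Adj}(X)$ is adjoined at $X$, with probability $\phi(X\mapsto t)$, this $t$ then occurring at level $i+1$, or no adjunction takes place at $X$, with probability $\phi(X\mapsto nil)$. A (complete) derivation is one in which this process stops after finitely many levels. Its probability is the product of the probability of the initial choice and of all the $\phi$-values used, including those of the $nil$ choices. A derivation yields the string in $\Sigma^*$ read from the leaves of the resulting derived tree. $\Pr(v)$ is the sum of the probabilities of all complete derivations yielding $v$, and $L(G)$ is the set of strings generated by $G$ (with $\Pr(v)=0$ for $v\notin L(G)$). $G$ is consistent if $\sum_{v\in L(G)}\Pr(v)=1$. **Stochastic expectation matrix.** Enumerate $\mathcal{I}\cup\mathcal{A}=\{t_1,\dots,t_m\}$.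 Let $\mathbf{P}$ be the $k\times m$ matrix with $\mathbf{P}_{ij}=\phi(X_i\mapsto t_j)$, and let $\mathbf{N}$ be the $m\times k$ matrix with $\mathbf{N}_{ij}=1$ if $X_j$ is a node of $t_i$ and $\mathbf{N}_{ij}=0$ otherwise. Then $\mathcal{M}=\mathbf{P}\cdot\mathbf{N}$, a $k\times k$ matrix; $\rho(\mathcal{M})$ is the largest modulus of an eigenvalue of $\mathcal{M}$. *)

theory Defs
  imports "HOL-Analysis.Infinite_Sum" "Jordan_Normal_Form.Spectral_Radius"
begin

section \<open>Trees and adjunction\<close>

text \<open>Leaf None is a leaf labelled by the empty string. A foot node is a leaf with a
  non-terminal label. Nodes of a tree are given by their Gorn addresses.\<close>

datatype ('n, 's) tree =
    Internal 'n "('n, 's) tree list"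
  | Leaf "'s option"
  | Foot 'n

type_synonym addr = "nat list"

fun wf_tree :: "'n set \<Rightarrow> 's set \<Rightarrow> ('n, 's) tree \<Rightarrow> bool" where
  "wf_tree N \<Sigma> (Internal A ts) \<longleftrightarrow> A \<in> N \<and> ts \<noteq> [] \<and> (\<forall>t \<in> set ts. wf_tree N \<Sigma> t)"
| "wf_tree N \<Sigma> (Leaf None) \<longleftrightarrow> True"
| "wf_tree N \<Sigma> (Leaf (Some a)) \<longleftrightarrow> a \<in> \<Sigma>"
| "wf_tree N \<Sigma> (Foot A) \<longleftrightarrow> A \<in> N"

fun subtree_at :: "('n, 's) tree \<Rightarrow> addr \<Rightarrow> ('n, 's) tree option" where
  "subtree_at t [] = Some t"
| "subtree_at (Internal A ts) (i # p) = (if i < length ts then subtree_at (ts ! i) p else None)"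
| "subtree_at (Leaf x) (i # p) = None"
| "subtree_at (Foot A) (i # p) = None"

definition addresses :: "('n, 's) tree \<Rightarrow> addr set" where
  "addresses t = {p. subtree_at t p \<noteq> None}"

text \<open>The non-terminal at the root; None if the root is labelled by a terminal or the
  empty string.\<close>

fun root_label :: "('n, 's) tree \<Rightarrow> 'n option" where
  "root_label (Internal A ts) = Some A"
| "root_label (Leaf x) = None"
| "root_label (Foot A) = Some A"

fun feet :: "('n, 's) tree \<Rightarrow> 'n list" where
  "feet (Internal A ts) = concat (map feet ts)"
| "feet (Leaf x) = []"
| "feet (Foot A) = [A]"

definition initial_tree :: "('n, 's) tree \<Rightarrow> bool" where
  "initial_tree t \<longleftrightarrow> feet t = []"

definition auxiliary_tree :: "('n, 's) tree \<Rightarrow> bool" where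
  "auxiliary_tree t \<longleftrightarrow> (\<exists>A. feet t = [A] \<and> root_label t = Some A)"

fun tree_yield :: "('n, 's) tree \<Rightarrow> 's list" where
  "tree_yield (Internal A ts) = concat (map tree_yield ts)"
| "tree_yield (Leaf None) = []"
| "tree_yield (Leaf (Some a)) = [a]"
| "tree_yield (Foot A) = []"

text \<open>The tree put in place of the subtree s when t is adjoined at the root of s:
  s is attached at the foot node of t.\<close>

fun adjoin :: "('n, 's) tree \<Rightarrow> ('n, 's) tree \<Rightarrow> ('n, 's) tree" where
  "adjoin (Internal A ts) s = Internal A (map (\<lambda>t. adjoin t s) ts)"
| "adjoin (Leaf x) s = Leaf x"
| "adjoin (Foot A) s = s"

text \<open>Adjunction at several nodes of one tree: f p is the tree adjoined at the node with
  address p of the original tree, if any. Working bottom-up keeps the original addresses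
  meaningful. Only internal nodes matter: leaves and foot nodes never admit adjunction.\<close>

function adjoin_all :: "(addr \<Rightarrow> ('n, 's) tree option) \<Rightarrow> ('n, 's) tree \<Rightarrow> ('n, 's) tree" where
  "adjoin_all f (Internal A ts) =
     (let s = Internal A (map (\<lambda>i. adjoin_all (\<lambda>p. f (i # p)) (ts ! i)) [0..<length ts])
      in case f [] of None \<Rightarrow> s | Some t \<Rightarrow> adjoin t s)"
| "adjoin_all f (Leaf x) = Leaf x"
| "adjoin_all f (Foot A) = Foot A"
  by pat_completeness auto
termination
  by (relation "measure (\<lambda>(f, t). size t)")
    (auto simp: less_Suc_eq_le intro!: size_list_estimation'[OF nth_mem])


section \<open>Probabilistic tree adjoining grammars\<close>

text \<open>Elementary trees are referred to by names in 'e, so that a grammar may contain several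
  isomorphic elementary trees and nodes of distinct elementary trees are distinct: a node is a
  pair of a name and an address. The sets of names are inits and auxs, and tree_of G gives the
  trees themselves. The function phi assigns a probability to (X, Some t), the adjunction of t
  at X, and to (X, None), no adjunction at X. The start tree contributes to a derivation only
  the random choice of the initial tree, with probabilities init_prob.\<close>

record ('e, 'n, 's) ptag =
  nonterminals :: "'n set"
  terminals :: "'s set"
  inits :: "'e set"
  auxs :: "'e set"
  tree_of :: "'e \<Rightarrow> ('n, 's) tree"
  start :: 'n
  Adj :: "'e \<times> addr \<Rightarrow> 'e set"
  phi :: "'e \<times> addr \<Rightarrow> 'e option \<Rightarrow> real"
  init_prob :: "'e \<Rightarrow> real"

definition elementary :: "('e, 'n, 's) ptag \<Rightarrow> 'e set" where
  "elementary G = inits G \<union> auxs G"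

definition nodes_of :: "('e, 'n, 's) ptag \<Rightarrow> 'e \<Rightarrow> ('e \<times> addr) set" where
  "nodes_of G t = {t} \<times> addresses (tree_of G t)"

definition node_subtree :: "('e, 'n, 's) ptag \<Rightarrow> 'e \<times> addr \<Rightarrow> ('n, 's) tree" where
  "node_subtree G X = the (subtree_at (tree_of G (fst X)) (snd X))"

definition node_label :: "('e, 'n, 's) ptag \<Rightarrow> 'e \<times> addr \<Rightarrow> 'n option" where
  "node_label G X = root_label (node_subtree G X)"

definition adj_nodes :: "('e, 'n, 's) ptag \<Rightarrow> ('e \<times> addr) set" where
  "adj_nodes G = {X \<in> (\<Union>t \<in> elementary G. nodes_of G t). Adj G X \<noteq> {}}"

definition start_trees :: "('e, 'n, 's) ptag \<Rightarrow> 'e set" where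
  "start_trees G = {t \<in> inits G. root_label (tree_of G t) = Some (start G)}"

definition probabilistic_tag :: "('e, 'n, 's) ptag \<Rightarrow> bool" where
  "probabilistic_tag G \<longleftrightarrow>
     finite (nonterminals G) \<and> finite (terminals G) \<and> start G \<in> nonterminals G \<and>
     finite (inits G) \<and> finite (auxs G) \<and>
     (\<forall>t \<in> elementary G. wf_tree (nonterminals G) (terminals G) (tree_of G t)) \<and>
     (\<forall>t \<in> inits G. initial_tree (tree_of G t)) \<and>
     (\<forall>t \<in> auxs G. auxiliary_tree (tree_of G t)) \<and>
     (\<forall>t \<in> elementary G. \<forall>X \<in> nodes_of G t.
        Adj G X \<subseteq> {u \<in> auxs G. root_label (tree_of G u) = node_label G X}) \<and>
     (\<forall>X \<in> adj_nodes G. 0 \<le> phi G X None \<and> phi G X None \<le> 1) \<and>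
     (\<forall>X \<in> adj_nodes G. \<forall>t \<in> Adj G X. 0 \<le> phi G X (Some t) \<and> phi G X (Some t) \<le> 1) \<and>
     (\<forall>X \<in> adj_nodes G. \<forall>t \<in> elementary G - Adj G X. phi G X (Some t) = 0)"

definition lexicalized :: "('e, 'n, 's) ptag \<Rightarrow> bool" where
  "lexicalized G \<longleftrightarrow>
     (\<forall>t \<in> elementary G. \<exists>p. \<exists>a \<in> terminals G. subtree_at (tree_of G t) p = Some (Leaf (Some a)))"

definition proper :: "('e, 'n, 's) ptag \<Rightarrow> bool" where
  "proper G \<longleftrightarrow> (\<forall>X \<in> adj_nodes G. phi G X None + (\<Sum>t \<in> Adj G X. phi G X (Some t)) = 1)"

definition no_foot_adjunction :: "('e, 'n, 's) ptag \<Rightarrow> bool" where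
  "no_foot_adjunction G \<longleftrightarrow>
     (\<forall>t \<in> auxs G. \<forall>X \<in> nodes_of G t. (\<exists>A. node_subtree G X = Foot A) \<longrightarrow> Adj G X = {})"

definition start_distribution :: "('e, 'n, 's) ptag \<Rightarrow> bool" where
  "start_distribution G \<longleftrightarrow>
     (\<forall>t \<in> start_trees G. 0 \<le> init_prob G t) \<and> (\<Sum>t \<in> start_trees G. init_prob G t) = 1"


section \<open>Derivations and string probabilities\<close>

text \<open>Deriv t g is a run from one occurrence of the elementary tree t: g p is the run started
  from the auxiliary tree adjoined at the node with address p, and None if nothing is adjoined
  there. Elements of the datatype are well-founded and, by the next predicate, adjunctions
  happen only at the finitely many nodes in adj_nodes G. So they are exactly the runs that stop
  after finitely many levels.\<close>

datatype 'e deriv = Deriv (root: 'e) (adjs: "addr \<Rightarrow> 'e deriv option")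

inductive run :: "('e, 'n, 's) ptag \<Rightarrow> 'e deriv \<Rightarrow> bool" for G where
  "t \<in> elementary G \<Longrightarrow>
   (\<And>p d. g p = Some d \<Longrightarrow> (t, p) \<in> adj_nodes G \<and> root d \<in> Adj G (t, p) \<and> run G d) \<Longrightarrow>
   run G (Deriv t g)"

definition derivations :: "('e, 'n, 's) ptag \<Rightarrow> 'e deriv set" where
  "derivations G = {d. run G d \<and> root d \<in> start_trees G}"

text \<open>The tree derived from an auxiliary tree still has its foot node, and is itself adjoined
  at the respective node of the tree one level above.\<close>

primrec derived_tree :: "('e, 'n, 's) ptag \<Rightarrow> 'e deriv \<Rightarrow> ('n, 's) tree" where
  "derived_tree G (Deriv t g) = adjoin_all (\<lambda>p. map_option (derived_tree G) (g p)) (tree_of G t)"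

definition deriv_yield :: "('e, 'n, 's) ptag \<Rightarrow> 'e deriv \<Rightarrow> 's list" where
  "deriv_yield G d = tree_yield (derived_tree G d)"

text \<open>The product of all phi-values used, including those for no adjunction.\<close>

primrec run_prob :: "('e, 'n, 's) ptag \<Rightarrow> 'e deriv \<Rightarrow> real" where
  "run_prob G (Deriv t g) =
     (\<Prod>p | (t, p) \<in> adj_nodes G.
        phi G (t, p) (map_option root (g p)) *
        (case map_option (run_prob G) (g p) of None \<Rightarrow> 1 | Some q \<Rightarrow> q))"

definition deriv_prob :: "('e, 'n, 's) ptag \<Rightarrow> 'e deriv \<Rightarrow> real" where
  "deriv_prob G d = init_prob G (root d) * run_prob G d"

definition string_prob :: "('e, 'n, 's) ptag \<Rightarrow> 's list \<Rightarrow> real" where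
  "string_prob G v = (\<Sum>\<^sub>\<infinity>d \<in> {d \<in> derivations G. deriv_yield G d = v}. deriv_prob G d)"

definition language :: "('e, 'n, 's) ptag \<Rightarrow> 's list set" where
  "language G = deriv_yield G ` derivations G"

definition consistent :: "('e, 'n, 's) ptag \<Rightarrow> bool" where
  "consistent G \<longleftrightarrow> (string_prob G has_sum 1) (language G)"


section \<open>The stochastic expectation matrix\<close>

text \<open>Xs and ts enumerate the nodes in adj_nodes G and the elementary trees of G.\<close>

definition P_mat :: "('e, 'n, 's) ptag \<Rightarrow> ('e \<times> addr) list \<Rightarrow> 'e list \<Rightarrow> real mat" where
  "P_mat G Xs ts = mat (length Xs) (length ts) (\<lambda>(i, j). phi G (Xs ! i) (Some (ts ! j)))"

definition N_mat :: "('e, 'n, 's) ptag \<Rightarrow> ('e \<times> addr) list \<Rightarrow> 'e list \<Rightarrow> real mat" where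
  "N_mat G Xs ts =
     mat (length ts) (length Xs) (\<lambda>(i, j). if Xs ! j \<in> nodes_of G (ts ! i) then 1 else 0)"

definition expectation_mat :: "('e, 'n, 's) ptag \<Rightarrow> ('e \<times> addr) list \<Rightarrow> 'e list \<Rightarrow> real mat" where
  "expectation_mat G Xs ts = P_mat G Xs ts * N_mat G Xs ts"

text \<open>The library's spectral radius is a maximum over the spectrum, hence unspecified for the
  empty matrix, which arises if no adjunction is possible at all. It is taken to be 0 then.\<close>

definition rho :: "real mat \<Rightarrow> real" where
  "rho M = (if dim_row M = 0 then 0 else spectral_radius (map_mat complex_of_real M))"

end

theory Submission
  imports Defs "HOL-Analysis.Infinite_Products"
begin

text \<open>The runs from t with at most n levels have total probability run_mass G n t, which satisfies
  a recursion of branching-process type: it is a product over the nodes of t. By the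
  Weierstrass inequality the mass still missing from 1 grows at most linearly in the missing
  masses one level below, so that the vector of missing masses at the nodes is dominated by
  powers of the expectation matrix. These tend to 0 when the spectral radius is below 1, so
  the terminating runs carry the whole probability.\<close>

section \<open>Powers of matrices with spectral radius below one\<close>

lemma pow_mat_smult:
  fixes A :: "'a :: comm_semiring_1 mat"
  assumes "A \<in> carrier_mat n n"
  shows "(c \<cdot>\<^sub>m A) ^\<^sub>m k = c ^ k \<cdot>\<^sub>m (A ^\<^sub>m k)"
proof (induction k)
  case 0
  show ?case using assms by auto
next
  case (Suc k)
  have P: "A ^\<^sub>m k \<in> carrier_mat n n" using assms by simp
  have "(c \<cdot>\<^sub>m A) ^\<^sub>m Suc k = (c ^ k \<cdot>\<^sub>m A ^\<^sub>m k) * (c \<cdot>\<^sub>m A)"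
    by (simp add: Suc)
  also have "\<dots> = c ^ k \<cdot>\<^sub>m (c \<cdot>\<^sub>m (A ^\<^sub>m k * A))"
    using mult_smult_assoc_mat[OF P, of "c \<cdot>\<^sub>m A" n] mult_smult_distrib[OF P assms] assms by simp
  also have "\<dots> = c ^ Suc k \<cdot>\<^sub>m (A ^\<^sub>m k * A)"
    by (rule eq_matI) (auto simp: ac_simps)
  finally show ?case by simp
qed

text \<open>An eigenvector of the scaled matrix for \<open>z\<close> is one of \<open>A\<close> for
  \<open>z / c\<close>; \<open>z\<close> is chosen of maximal modulus.\<close>

lemma spectral_radius_smult_le:
  fixes A :: "complex mat"
  assumes A: "A \<in> carrier_mat n n" and "n > 0" and "c \<noteq> 0"
  shows "spectral_radius (c \<cdot>\<^sub>m A) \<le> norm c * spectral_radius A"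
proof -
  have cA: "c \<cdot>\<^sub>m A \<in> carrier_mat n n" using A by simp
  obtain z where z: "z \<in> spectrum (c \<cdot>\<^sub>m A)" "spectral_radius (c \<cdot>\<^sub>m A) = norm z"
    using spectral_radius_mem_max(1)[OF cA \<open>n > 0\<close>] by auto
  then obtain v where v: "v \<in> carrier_vec n" "v \<noteq> 0\<^sub>v n" and eq: "(c \<cdot>\<^sub>m A) *\<^sub>v v = z \<cdot>\<^sub>v v"
    using cA A by (auto simp: spectrum_def eigenvalue_def eigenvector_def)
  have "A *\<^sub>v v = (z / c) \<cdot>\<^sub>v v"
  proof (rule eq_vecI)
    fix i assume "i < dim_vec ((z / c) \<cdot>\<^sub>v v)"
    then have i: "i < n" using v by simp
    have "c * (A *\<^sub>v v) $ i = ((c \<cdot>\<^sub>m A) *\<^sub>v v) $ i"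
      using i A v by (simp add: scalar_prod_def sum_distrib_left ac_simps)
    also have "\<dots> = z * v $ i" unfolding eq using i v by simp
    finally show "(A *\<^sub>v v) $ i = ((z / c) \<cdot>\<^sub>v v) $ i"
      using i v \<open>c \<noteq> 0\<close> by (simp add: field_simps)
  qed (use A v in auto)
  then have "z / c \<in> spectrum A"
    using v A by (auto simp: spectrum_def eigenvalue_def eigenvector_def)
  then have "norm (z / c) \<le> spectral_radius A"
    by (intro spectral_radius_mem_max(2)[OF A \<open>n > 0\<close>]) auto
  then show ?thesis using z \<open>c \<noteq> 0\<close> by (simp add: norm_divide field_simps)
qed

text \<open>For r strictly between the spectral radius and 1, the powers of A / r are bounded, hence
  those of A decay like r ^ k.\<close>

lemma pow_mat_tendsto_0:
  fixes A :: "complex mat"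
  assumes A: "A \<in> carrier_mat n n" and sr: "spectral_radius A < 1" and ij: "i < n" "j < n"
  shows "(\<lambda>k. (A ^\<^sub>m k) $$ (i, j)) \<longlonglongrightarrow> 0"
proof -
  have n: "n > 0" using ij by simp
  \<comment> \<open>The maximum with 0 gives \<open>r > 0\<close> at once, as the division by
    \<open>r\<close> requires.\<close>
  obtain r where r: "max 0 (spectral_radius A) < r" "r < 1"
    using dense[of "max 0 (spectral_radius A)" 1] sr by auto
  define c where "c = complex_of_real (1 / r)"
  have c: "c \<noteq> 0" "norm c = 1 / r" using r by (simp_all add: c_def norm_divide)
  have cA: "c \<cdot>\<^sub>m A \<in> carrier_mat n n" using A by simp
  have "norm c * spectral_radius A < 1" unfolding c(2) using r by simp
  then have "spectral_radius (c \<cdot>\<^sub>m A) < 1"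
    using spectral_radius_smult_le[OF A n \<open>c \<noteq> 0\<close>] by simp
  then obtain b where b: "\<And>k. norm_bound ((c \<cdot>\<^sub>m A) ^\<^sub>m k) b"
    using spectral_radius_jnf_norm_bound_less_1_upper_triangular[OF cA] by blast
  have "norm ((A ^\<^sub>m k) $$ (i, j)) \<le> b * r ^ k" for k
  proof -
    have "norm (((c \<cdot>\<^sub>m A) ^\<^sub>m k) $$ (i, j)) \<le> b"
      using b[of k] ij cA A unfolding norm_bound_def by (simp split: if_splits)
    moreover have "((c \<cdot>\<^sub>m A) ^\<^sub>m k) $$ (i, j) = c ^ k * (A ^\<^sub>m k) $$ (i, j)"
      using A ij by (simp add: pow_mat_smult[OF A])
    ultimately show ?thesis
      using r c by (simp add: norm_mult norm_power power_divide field_simps)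
  qed
  moreover have "(\<lambda>k. b * r ^ k) \<longlonglongrightarrow> 0"
    using r by (intro tendsto_mult_right_zero LIMSEQ_realpow_zero) auto
  ultimately show ?thesis
    by (rule Lim_null_comparison[OF always_eventually[OF allI]])
qed

text \<open>A nonnegative matrix preserves entrywise inequalities, so iterating \<open>y_Suc\<close>
  bounds \<open>y k\<close> by the k-th power of \<open>M\<close> applied to \<open>y 0\<close>, and
  these powers tend to 0.\<close>

lemma subinvariant_tendsto_0:
  fixes y :: "nat \<Rightarrow> nat \<Rightarrow> real"
  assumes M: "M \<in> carrier_mat n n" and M_nonneg: "\<And>i j. i < n \<Longrightarrow> j < n \<Longrightarrow> 0 \<le> M $$ (i, j)"
    and rho: "rho M < 1"
    and y_nonneg: "\<And>k i. i < n \<Longrightarrow> 0 \<le> y k i"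
    and y_Suc: "\<And>k i. i < n \<Longrightarrow> y (Suc k) i \<le> (\<Sum>j<n. M $$ (i, j) * y k j)"
    and i: "i < n"
  shows "(\<lambda>k. y k i) \<longlonglongrightarrow> 0"
proof -
  have P: "M ^\<^sub>m k \<in> carrier_mat n n" for k using M by simp
  have pow_Suc: "(M ^\<^sub>m Suc k) $$ (i, j) = (\<Sum>l<n. (M ^\<^sub>m k) $$ (i, l) * M $$ (l, j))"
    if "i < n" "j < n" for i j k
    using that M P[of k] by (simp add: scalar_prod_def lessThan_atLeast0)
  have pow_nonneg: "0 \<le> (M ^\<^sub>m k) $$ (i, j)" if "i < n" "j < n" for i j k
    using that
  proof (induction k arbitrary: i j)
    case 0
    then show ?case using M by simp
  next
    case (Suc k)
    show ?case unfolding pow_Suc[OF Suc.prems]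
      using Suc M_nonneg by (intro sum_nonneg mult_nonneg_nonneg) auto
  qed
  \<comment> \<open>The starting index \<open>m\<close> is arbitrary because the induction step uses
    the hypothesis at \<open>Suc m\<close> and then applies \<open>y_Suc\<close> once.\<close>
  have bound: "y (k + m) i \<le> (\<Sum>j<n. (M ^\<^sub>m k) $$ (i, j) * y m j)" for k m
  proof (induction k arbitrary: m)
    case 0
    have "(\<Sum>j<n. (M ^\<^sub>m 0) $$ (i, j) * y m j) = (\<Sum>j<n. if i = j then y m j else 0)"
      using M i by (intro sum.cong) auto
    then show ?case using i by simp
  next
    case (Suc k)
    have "y (Suc k + m) i \<le> (\<Sum>l<n. (M ^\<^sub>m k) $$ (i, l) * y (Suc m) l)"
      using Suc[of "Suc m"] by simp
    also have "\<dots> \<le> (\<Sum>l<n. (M ^\<^sub>m k) $$ (i, l) * (\<Sum>j<n. M $$ (l, j) * y m j))"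
      using y_Suc pow_nonneg i by (intro sum_mono mult_left_mono) auto
    also have "\<dots> = (\<Sum>l<n. \<Sum>j<n. (M ^\<^sub>m k) $$ (i, l) * M $$ (l, j) * y m j)"
      by (simp add: sum_distrib_left ac_simps)
    also have "\<dots> = (\<Sum>j<n. \<Sum>l<n. (M ^\<^sub>m k) $$ (i, l) * M $$ (l, j) * y m j)"
      by (rule sum.swap)
    also have "\<dots> = (\<Sum>j<n. (M ^\<^sub>m Suc k) $$ (i, j) * y m j)"
      by (intro sum.cong refl) (use pow_Suc i in \<open>auto simp: sum_distrib_right\<close>)
    finally show ?case .
  qed
  \<comment> \<open>Spectral radii are taken over the complex numbers; powers commute with the
    embedding of the reals, and real parts lead back. As \<open>i < n\<close>, the matrix is not
    empty and the default value of \<open>rho\<close> does not occur.\<close>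
  let ?C = "map_mat complex_of_real M"
  have C: "?C \<in> carrier_mat n n" using M by simp
  have "spectral_radius ?C < 1" using rho M i by (auto simp: rho_def)
  then have "(\<lambda>k. (?C ^\<^sub>m k) $$ (i, j)) \<longlonglongrightarrow> 0" if "j < n" for j
    using pow_mat_tendsto_0[OF C _ i that] by simp
  moreover have "(?C ^\<^sub>m k) $$ (i, j) = complex_of_real ((M ^\<^sub>m k) $$ (i, j))" if "j < n" for k j
    using of_real_hom.mat_hom_pow[OF M, of k, where 'a = complex, symmetric] that i carrier_matD[OF P[of k]] by simp
  ultimately have lim: "(\<lambda>k. complex_of_real ((M ^\<^sub>m k) $$ (i, j))) \<longlonglongrightarrow> 0" if "j < n" for j
    using that by simp
  have "(\<lambda>k. (M ^\<^sub>m k) $$ (i, j)) \<longlonglongrightarrow> 0" if "j < n" for j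
    using tendsto_Re[OF lim[OF that]] by simp
  then have "(\<lambda>k. \<Sum>j<n. (M ^\<^sub>m k) $$ (i, j) * y 0 j) \<longlonglongrightarrow> 0"
    by (intro tendsto_null_sum tendsto_mult_left_zero) auto
  moreover have "norm (y k i) \<le> (\<Sum>j<n. (M ^\<^sub>m k) $$ (i, j) * y 0 j)" for k
    using bound[of k 0] y_nonneg[OF i, of k] by simp
  ultimately show ?thesis
    by (rule Lim_null_comparison[OF always_eventually[OF allI], rotated])
qed

section \<open>Sums over increasing unions and over fibres\<close>

text \<open>Every finite subset of the union lies in some \<open>A n\<close>, so with nonnegative
  terms its sum is at most \<open>s\<close>; every finite subset containing a late
  \<open>A n\<close> has a sum close to \<open>s\<close>.\<close>

lemma has_sum_UN_incseq:
  fixes f :: "'a \<Rightarrow> real"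
  assumes fin: "\<And>n. finite (A n)" and "incseq A"
    and nonneg: "\<And>x. x \<in> (\<Union>n. A n) \<Longrightarrow> 0 \<le> f x"
    and lim: "(\<lambda>n. sum f (A n)) \<longlonglongrightarrow> s"
  shows "(f has_sum s) (\<Union>n. A n)"
proof -
  have inc: "incseq (\<lambda>n. sum f (A n))"
  proof (rule incseq_SucI)
    fix n
    show "sum f (A n) \<le> sum f (A (Suc n))"
      using incseq_SucD[OF \<open>incseq A\<close>, of n] fin nonneg by (intro sum_mono2) auto
  qed
  have le: "sum f F \<le> s" if F: "finite F" "F \<subseteq> (\<Union>n. A n)" for F
  proof -
    have "\<exists>n. F \<subseteq> A n"
      using F
    proof (induction F rule: finite_induct)
      case (insert x F)
      then obtain m n where "x \<in> A m" "F \<subseteq> A n" by auto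
      then have "insert x F \<subseteq> A (max m n)"
        using incseqD[OF \<open>incseq A\<close>, of m "max m n"] incseqD[OF \<open>incseq A\<close>, of n "max m n"] by auto
      then show ?case by blast
    qed simp
    then obtain n where "F \<subseteq> A n" by blast
    then have "sum f F \<le> sum f (A n)" using fin nonneg by (intro sum_mono2) auto
    also have "\<dots> \<le> s" by (rule incseq_le[OF inc lim])
    finally show ?thesis .
  qed
  show ?thesis unfolding has_sum_def
  proof (rule order_tendstoI)
    fix a assume "a < s"
    then obtain n where n: "a < sum f (A n)"
      using order_tendstoD(1)[OF lim] by (auto simp: eventually_sequentially)
    have "a < sum f F" if "finite F" "F \<subseteq> (\<Union>n. A n)" "A n \<subseteq> F" for F
      using n that nonneg sum_mono2[of F "A n" f] by force
    then show "eventually (\<lambda>F. a < sum f F) (finite_subsets_at_top (\<Union>n. A n))"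
      unfolding eventually_finite_subsets_at_top using fin by (intro exI[of _ "A n"]) auto
  next
    fix a assume "s < a"
    then show "eventually (\<lambda>F. sum f F < a) (finite_subsets_at_top (\<Union>n. A n))"
      unfolding eventually_finite_subsets_at_top using le by (intro exI[of _ "{}"]) (auto intro: le_less_trans)
  qed
qed

text \<open>\<open>A\<close> is the disjoint union of the fibres of \<open>h\<close>, written as a
  dependent sum so that the summation can be iterated. Completeness makes \<open>f\<close> summable
  on each fibre.\<close>

lemma has_sum_fibres:
  fixes f :: "'a \<Rightarrow> 'c :: banach"
  assumes "(f has_sum s) A"
  shows "((\<lambda>v. \<Sum>\<^sub>\<infinity>x \<in> {x \<in> A. h x = v}. f x) has_sum s) (h ` A)"
proof -
  let ?S = "SIGMA v:h ` A. {x \<in> A. h x = v}"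
  have "inj_on snd ?S" by (rule inj_onI) auto
  moreover have "snd ` ?S = A" by force
  ultimately have "bij_betw snd ?S A" by (simp only: bij_betw_def)
  then have "((\<lambda>p. f (snd p)) has_sum s) ?S"
    using assms by (simp add: has_sum_reindex_bij_betw)
  moreover have "((\<lambda>x. f x) has_sum (\<Sum>\<^sub>\<infinity>x \<in> {x \<in> A. h x = v}. f x)) {x \<in> A. h x = v}" for v
    by (rule has_sum_infsum, rule summable_on_subset_banach[of f A])
      (use has_sum_imp_summable[OF assms] in auto)
  ultimately show ?thesis
    by (intro has_sum_Sigma[OF isUCont_plus, where f = "\<lambda>p. f (snd p)" and B = "\<lambda>v. {x \<in> A. h x = v}"])
      simp_all
qed

section \<open>Runs of bounded depth\<close>

text \<open>A tree without adjunctions already counts as one level, so the recursion starts with the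
  empty set. The root may be any elementary tree, not only a start tree, because the recursion
  descends into auxiliary trees.\<close>

primrec runs_upto :: "('e, 'n, 's) ptag \<Rightarrow> nat \<Rightarrow> 'e deriv set" where
  "runs_upto G 0 = {}"
| "runs_upto G (Suc n) = {d. root d \<in> elementary G \<and>
     (\<forall>p d'. adjs d p = Some d' \<longrightarrow>
        (root d, p) \<in> adj_nodes G \<and> root d' \<in> Adj G (root d, p) \<and> d' \<in> runs_upto G n)}"

text \<open>The probability that the branching process started from \<open>t\<close> dies out within
  \<open>n\<close> levels. In the locale below, \<open>finite_runs_upto\<close> makes the index set
  finite.\<close>

definition run_mass :: "('e, 'n, 's) ptag \<Rightarrow> nat \<Rightarrow> 'e \<Rightarrow> real" where
  "run_mass G n t = (\<Sum>d | d \<in> runs_upto G n \<and> root d = t. run_prob G d)"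

text \<open>The probability that some tree is adjoined at X and the run below it does not stop within
  n levels.\<close>

definition lost_mass :: "('e, 'n, 's) ptag \<Rightarrow> nat \<Rightarrow> 'e \<times> addr \<Rightarrow> real" where
  "lost_mass G n X = (\<Sum>u \<in> Adj G X. phi G X (Some u) * (1 - run_mass G n u))"

lemma incseq_runs_upto: "incseq (runs_upto G)"
proof (rule incseq_SucI)
  show "runs_upto G n \<subseteq> runs_upto G (Suc n)" for n
  proof (induction n)
    case (Suc n)
    then show ?case unfolding runs_upto.simps(2)[of G "Suc n"] by (subst runs_upto.simps(2)) blast
  qed simp
qed

lemma run_if_runs_upto: "d \<in> runs_upto G n \<Longrightarrow> run G d"
proof (induction n arbitrary: d)
  case (Suc n)
  then show ?case by (cases d) (auto intro!: run.intros)
qed simp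

section \<open>Finiteness, sign and normalization of the adjunction probabilities\<close>

locale proper_ptag =
  fixes G :: "('e, 'n, 's) ptag"
  assumes ptag: "probabilistic_tag G" and proper: "proper G"
    and finite_adj_nodes: "finite (adj_nodes G)"
begin

definition sites :: "'e \<Rightarrow> addr set" where
  "sites t = {p. (t, p) \<in> adj_nodes G}"

lemma finite_sites: "finite (sites t)"
proof (rule finite_imageD)
  show "finite (Pair t ` sites t)"
    by (rule finite_subset[OF _ finite_adj_nodes]) (auto simp: sites_def)
qed (simp add: inj_on_def)

lemma finite_elementary: "finite (elementary G)"
  using ptag by (simp add: probabilistic_tag_def elementary_def)

lemma fst_adj_node: "X \<in> adj_nodes G \<Longrightarrow> fst X \<in> elementary G"
  by (auto simp: adj_nodes_def nodes_of_def)

lemma Adj_subset: "X \<in> adj_nodes G \<Longrightarrow> Adj G X \<subseteq> elementary G"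
  using ptag unfolding probabilistic_tag_def adj_nodes_def elementary_def by blast

lemma finite_Adj: "X \<in> adj_nodes G \<Longrightarrow> finite (Adj G X)"
  using Adj_subset finite_elementary finite_subset by blast

lemma phi_None_nonneg: "X \<in> adj_nodes G \<Longrightarrow> 0 \<le> phi G X None"
  using ptag by (simp add: probabilistic_tag_def)

lemma phi_Some_nonneg: "X \<in> adj_nodes G \<Longrightarrow> u \<in> Adj G X \<Longrightarrow> 0 \<le> phi G X (Some u)"
  using ptag by (simp add: probabilistic_tag_def)

lemma phi_Some_eq_0: "X \<in> adj_nodes G \<Longrightarrow> u \<in> elementary G \<Longrightarrow> u \<notin> Adj G X \<Longrightarrow> phi G X (Some u) = 0"
  using ptag by (simp add: probabilistic_tag_def)

lemma phi_sum: "X \<in> adj_nodes G \<Longrightarrow> phi G X None + (\<Sum>u \<in> Adj G X. phi G X (Some u)) = 1"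
  using proper by (simp add: proper_def)

section \<open>Decomposition of runs at the sites of the root\<close>

lemma run_prob_nonneg: "run G d \<Longrightarrow> 0 \<le> run_prob G d"
proof (induction rule: run.induct)
  case (1 t g)
  have "0 \<le> phi G (t, p) (map_option root (g p)) *
      (case map_option (run_prob G) (g p) of None \<Rightarrow> 1 | Some q \<Rightarrow> q)" if "(t, p) \<in> adj_nodes G" for p
    using 1(2)[of p] that by (cases "g p") (auto simp: phi_None_nonneg phi_Some_nonneg)
  then show ?case by (subst run_prob.simps, rule prod_nonneg) auto
qed

text \<open>Well-foundedness alone does not bound the depth, but each tree has finitely many sites,
  so the bounds for its adjoined runs have a maximum, and one more level suffices.\<close>

lemma UN_runs_upto: "(\<Union>n. runs_upto G n) = {d. run G d}"
proof (intro equalityI subsetI)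
  fix d assume "d \<in> {d. run G d}"
  then have "run G d" by simp
  then show "d \<in> (\<Union>n. runs_upto G n)"
  proof (induction rule: run.induct)
    case (1 t g)
    let ?D = "{d. \<exists>p. g p = Some d}"
    have "finite ?D"
    proof (rule finite_subset)
      show "?D \<subseteq> (\<lambda>p. the (g p)) ` sites t" using 1(2) by (force simp: sites_def)
    qed (simp add: finite_sites)
    moreover have "\<exists>n. d \<in> runs_upto G n" if "d \<in> ?D" for d using 1(2) that by blast
    then obtain N where N: "\<And>d. d \<in> ?D \<Longrightarrow> d \<in> runs_upto G (N d)" by metis
    \<comment> \<open>If nothing is adjoined, \<open>?D\<close> is empty and the maximum
      unspecified; the claim is then vacuous and any index works.\<close>
    ultimately have "d \<in> runs_upto G (Max (N ` ?D))" if "d \<in> ?D" for d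
      using that incseqD[OF incseq_runs_upto, of "N d" "Max (N ` ?D)" G] by (auto intro!: Max_ge)
    then have "Deriv t g \<in> runs_upto G (Suc (Max (N ` ?D)))" using 1 by auto
    then show ?case by blast
  qed
qed (auto intro: run_if_runs_upto)

text \<open>A run from \<open>t\<close> amounts to a separate choice at each site: no adjunction, or
  a permitted run of at most \<open>n\<close> levels. Functions in the product are
  \<open>undefined\<close> off the sites, while a run has \<open>None\<close> there, whence the
  conditional and, for the inverse, \<open>restrict\<close>.\<close>

lemma bij_betw_runs_upto_Suc:
  assumes "t \<in> elementary G"
  shows "bij_betw (\<lambda>g. Deriv t (\<lambda>p. if p \<in> sites t then g p else None))
     (\<Pi>\<^sub>E p \<in> sites t. insert None (Some ` {d \<in> runs_upto G n. root d \<in> Adj G (t, p)}))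
     {d \<in> runs_upto G (Suc n). root d = t}"
    (is "bij_betw ?D (Pi\<^sub>E _ ?B) ?R")
proof (rule bij_betw_byWitness[where f' = "\<lambda>d. restrict (adjs d) (sites t)"])
  show "\<forall>g \<in> Pi\<^sub>E (sites t) ?B. restrict (adjs (?D g)) (sites t) = g"
    by (auto simp: fun_eq_iff restrict_def PiE_def extensional_def)
  show "\<forall>d \<in> ?R. ?D (restrict (adjs d) (sites t)) = d"
  proof
    fix d assume d: "d \<in> ?R"
    have "(if p \<in> sites t then restrict (adjs d) (sites t) p else None) = adjs d p" for p
      using d by (cases "adjs d p") (auto simp: sites_def)
    with d show "?D (restrict (adjs d) (sites t)) = d" by (cases d) simp
  qed
  show "?D ` Pi\<^sub>E (sites t) ?B \<subseteq> ?R"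
    using assms by (fastforce simp: sites_def PiE_def Pi_def split: if_splits)
  show "(\<lambda>d. restrict (adjs d) (sites t)) ` ?R \<subseteq> Pi\<^sub>E (sites t) ?B"
  proof (intro image_subsetI restrict_PiE_iff[THEN iffD2] ballI)
    fix d p assume "d \<in> ?R"
    then show "adjs d p \<in> ?B p" by (cases "adjs d p") auto
  qed
qed

lemma finite_runs_upto: "finite (runs_upto G n)"
proof (induction n)
  case (Suc n)
  have "finite {d \<in> runs_upto G (Suc n). root d = t}" if "t \<in> elementary G" for t
    using bij_betw_finite[OF bij_betw_runs_upto_Suc[OF that, of n]] finite_sites Suc
    by (simp add: finite_PiE)
  then have "finite (\<Union>t \<in> elementary G. {d \<in> runs_upto G (Suc n). root d = t})"
    using finite_elementary by blast
  then show ?case by (rule rev_finite_subset) auto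
qed simp

text \<open>Runs are grouped by their root. The weight \<open>w\<close> is \<open>phi\<close> at one
  node in \<open>run_mass_Suc\<close> and \<open>init_prob\<close> in
  \<open>has_sum_deriv_prob\<close>.\<close>

lemma sum_runs_upto:
  assumes "finite U"
  shows "(\<Sum>d | d \<in> runs_upto G n \<and> root d \<in> U. w (root d) * run_prob G d)
    = (\<Sum>u \<in> U. w u * run_mass G n u)"
proof -
  let ?S = "{d. d \<in> runs_upto G n \<and> root d \<in> U}"
  have "(\<Sum>d \<in> ?S. w (root d) * run_prob G d)
      = (\<Sum>u \<in> U. \<Sum>d | d \<in> ?S \<and> root d = u. w (root d) * run_prob G d)"
    using assms finite_runs_upto by (intro sum.group[symmetric]) auto
  also have "\<dots> = (\<Sum>u \<in> U. w u * run_mass G n u)"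
    unfolding run_mass_def sum_distrib_left by (intro sum.cong) auto
  finally show ?thesis .
qed

text \<open>The choices at the sites are independent, so the sum over all runs factors
  (\<open>prod_sum_PiE\<close>). The factor of a site is the probability that nothing is adjoined
  there or that the run below it has at most \<open>n\<close> levels; by properness this is the
  complement of the lost mass.\<close>

lemma run_mass_Suc:
  assumes "t \<in> elementary G"
  shows "run_mass G (Suc n) t = (\<Prod>p \<in> sites t. 1 - lost_mass G n (t, p))"
proof -
  let ?A = "\<lambda>p. {d. d \<in> runs_upto G n \<and> root d \<in> Adj G (t, p)}"
  let ?B = "\<lambda>p. insert None (Some ` ?A p)"
  let ?f = "\<lambda>p x. phi G (t, p) (map_option root x) *
    (case map_option (run_prob G) x of None \<Rightarrow> 1 | Some q \<Rightarrow> q)"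
  let ?D = "\<lambda>g. Deriv t (\<lambda>p. if p \<in> sites t then g p else None)"
  have fin: "finite (?A p)" for p using finite_runs_upto by simp
  have "1 - lost_mass G n (t, p) = (\<Sum>x \<in> ?B p. ?f p x)" if "p \<in> sites t" for p
  proof -
    have X: "(t, p) \<in> adj_nodes G" using that by (simp add: sites_def)
    have "(\<Sum>x \<in> ?B p. ?f p x) = phi G (t, p) None + (\<Sum>x \<in> Some ` ?A p. ?f p x)"
      using fin by (subst sum.insert) auto
    also have "(\<Sum>x \<in> Some ` ?A p. ?f p x) = (\<Sum>d \<in> ?A p. phi G (t, p) (Some (root d)) * run_prob G d)"
      by (subst sum.reindex) auto
    also have "\<dots> = (\<Sum>u \<in> Adj G (t, p). phi G (t, p) (Some u) * run_mass G n u)"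
      by (rule sum_runs_upto[OF finite_Adj[OF X]])
    finally show ?thesis
      using phi_sum[OF X] by (simp add: lost_mass_def right_diff_distrib sum_subtractf)
  qed
  then have "(\<Prod>p \<in> sites t. 1 - lost_mass G n (t, p)) = (\<Prod>p \<in> sites t. \<Sum>x \<in> ?B p. ?f p x)"
    by (rule prod.cong[OF refl])
  also have "\<dots> = (\<Sum>g \<in> Pi\<^sub>E (sites t) ?B. \<Prod>p \<in> sites t. ?f p (g p))"
    using finite_sites fin by (intro prod_sum_PiE) auto
  also have "\<dots> = (\<Sum>g \<in> Pi\<^sub>E (sites t) ?B. run_prob G (?D g))"
    by (intro sum.cong) (auto simp: sites_def[symmetric] intro!: prod.cong)
  also have "\<dots> = run_mass G (Suc n) t"
    unfolding run_mass_def by (rule sum.reindex_bij_betw[OF bij_betw_runs_upto_Suc[OF assms]])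
  finally show ?thesis by simp
qed

section \<open>Bounds on the masses and the linear recursion\<close>

lemma lost_mass_nonneg_le_1:
  assumes X: "X \<in> adj_nodes G" and mass: "\<And>u. u \<in> elementary G \<Longrightarrow> run_mass G n u \<in> {0..1}"
  shows "lost_mass G n X \<in> {0..1}"
proof -
  have u: "0 \<le> phi G X (Some u)" "0 \<le> run_mass G n u" "run_mass G n u \<le> 1" if "u \<in> Adj G X" for u
    using that phi_Some_nonneg[OF X] mass Adj_subset[OF X] by auto
  have "lost_mass G n X \<le> (\<Sum>u \<in> Adj G X. phi G X (Some u))"
    unfolding lost_mass_def using u by (intro sum_mono mult_left_le) auto
  moreover have "0 \<le> lost_mass G n X"
    unfolding lost_mass_def using u by (intro sum_nonneg mult_nonneg_nonneg) auto
  ultimately show ?thesis using phi_sum[OF X] phi_None_nonneg[OF X] by simp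
qed

text \<open>The two bounds alternate: \<open>run_mass\<close> at \<open>n\<close> controls
  \<open>lost_mass\<close> at \<open>n\<close>, which controls \<open>run_mass\<close> at
  \<open>Suc n\<close>. Hence the preceding lemma takes the bound on \<open>run_mass\<close> as a
  hypothesis.\<close>

lemma run_mass_bounds: "t \<in> elementary G \<Longrightarrow> run_mass G n t \<in> {0..1}"
proof (induction n arbitrary: t)
  case 0
  show ?case by (simp add: run_mass_def)
next
  case (Suc n)
  have "lost_mass G n (t, p) \<in> {0..1}" if "p \<in> sites t" for p
    using lost_mass_nonneg_le_1[OF _ Suc.IH] that by (simp add: sites_def)
  then show ?case
    unfolding run_mass_Suc[OF Suc.prems] by (auto intro!: prod_nonneg prod_le_1)
qed

lemma lost_mass_bounds: "X \<in> adj_nodes G \<Longrightarrow> lost_mass G n X \<in> {0..1}"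
  using lost_mass_nonneg_le_1 run_mass_bounds by blast

text \<open>A union bound: a run exceeds \<open>Suc n\<close> levels only if the run below some site
  exceeds \<open>n\<close> levels.\<close>

lemma one_minus_run_mass_Suc_le:
  assumes "t \<in> elementary G"
  shows "1 - run_mass G (Suc n) t \<le> (\<Sum>p \<in> sites t. lost_mass G n (t, p))"
  using Weierstrass_prod_ineq[of "sites t" "\<lambda>p. lost_mass G n (t, p)"] lost_mass_bounds
  by (simp add: run_mass_Suc[OF assms] sites_def)

text \<open>The right-hand side is row \<open>X\<close> of the expectation matrix applied to the
  lost masses. The sum over \<open>Adj G X\<close> extends to all elementary trees because
  \<open>phi\<close> vanishes on the others; each node is then counted once, in the tree that
  contains it.\<close>

lemma lost_mass_Suc_le:
  assumes X: "X \<in> adj_nodes G"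
  shows "lost_mass G (Suc n) X \<le> (\<Sum>Y \<in> adj_nodes G. phi G X (Some (fst Y)) * lost_mass G n Y)"
proof -
  have "lost_mass G (Suc n) X
      \<le> (\<Sum>u \<in> Adj G X. phi G X (Some u) * (\<Sum>p \<in> sites u. lost_mass G n (u, p)))"
    unfolding lost_mass_def[of G "Suc n"]
    using phi_Some_nonneg[OF X] one_minus_run_mass_Suc_le Adj_subset[OF X] by (intro sum_mono mult_left_mono) auto
  also have "\<dots> = (\<Sum>u \<in> elementary G. phi G X (Some u) * (\<Sum>p \<in> sites u. lost_mass G n (u, p)))"
    using Adj_subset[OF X] finite_elementary phi_Some_eq_0[OF X] by (intro sum.mono_neutral_left) auto
  also have "\<dots> = (\<Sum>u \<in> elementary G. \<Sum>Y | Y \<in> adj_nodes G \<and> fst Y = u.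
      phi G X (Some (fst Y)) * lost_mass G n Y)"
  proof (intro sum.cong refl)
    fix u
    have "{Y. Y \<in> adj_nodes G \<and> fst Y = u} = Pair u ` sites u" by (auto simp: sites_def)
    then show "phi G X (Some u) * (\<Sum>p \<in> sites u. lost_mass G n (u, p))
        = (\<Sum>Y | Y \<in> adj_nodes G \<and> fst Y = u. phi G X (Some (fst Y)) * lost_mass G n Y)"
      by (simp add: sum.reindex inj_on_def sum_distrib_left)
  qed
  also have "\<dots> = (\<Sum>Y \<in> adj_nodes G. phi G X (Some (fst Y)) * lost_mass G n Y)"
    using finite_elementary finite_adj_nodes fst_adj_node by (intro sum.group) auto
  finally show ?thesis .
qed

section \<open>Comparison with the expectation matrix and passage to the limit\<close>

text \<open>Every node lies in exactly one elementary tree, so the sum defining the matrix product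
  has a single nonzero term.\<close>

lemma expectation_mat_entry:
  assumes "set Xs = adj_nodes G" "distinct ts" "set ts = elementary G" "i < length Xs" "j < length Xs"
  shows "expectation_mat G Xs ts $$ (i, j) = phi G (Xs ! i) (Some (fst (Xs ! j)))"
proof -
  have X: "Xs ! j \<in> adj_nodes G" using assms nth_mem by blast
  have node: "Xs ! j \<in> nodes_of G t \<longleftrightarrow> t = fst (Xs ! j)" for t
    using X by (auto simp: adj_nodes_def nodes_of_def)
  obtain l where l: "l < length ts" "ts ! l = fst (Xs ! j)"
    using fst_adj_node[OF X] assms(3) by (metis in_set_conv_nth)
  have "expectation_mat G Xs ts $$ (i, j)
      = (\<Sum>k < length ts. phi G (Xs ! i) (Some (ts ! k)) * (if ts ! k = fst (Xs ! j) then 1 else 0))"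
    using assms by (simp add: expectation_mat_def P_mat_def N_mat_def scalar_prod_def node lessThan_atLeast0)
  also have "\<dots> = (\<Sum>k < length ts. if k = l then phi G (Xs ! i) (Some (fst (Xs ! j))) else 0)"
    using l nth_eq_iff_index_eq[OF assms(2) _ l(1)]
    by (intro sum.cong refl) (simp add: l(2)[symmetric])
  finally show ?thesis using l by simp
qed

text \<open>Numbering the nodes by \<open>Xs\<close> turns \<open>lost_mass_Suc_le\<close> into the
  recursive inequality that \<open>subinvariant_tendsto_0\<close> requires.\<close>

lemma lost_mass_tendsto_0:
  assumes "distinct Xs" and Xs: "set Xs = adj_nodes G" and ts: "distinct ts" "set ts = elementary G"
    and rho: "rho (expectation_mat G Xs ts) < 1" and "X \<in> adj_nodes G"
  shows "(\<lambda>n. lost_mass G n X) \<longlonglongrightarrow> 0"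
proof -
  let ?M = "expectation_mat G Xs ts" and ?k = "length Xs"
  note entry = expectation_mat_entry[OF Xs ts]
  have node: "Xs ! i \<in> adj_nodes G" if "i < ?k" for i using that Xs nth_mem by blast
  obtain i where i: "i < ?k" "Xs ! i = X" using \<open>X \<in> adj_nodes G\<close> Xs by (metis in_set_conv_nth)
  have "?M \<in> carrier_mat ?k ?k"
    by (intro carrier_matI) (simp_all add: expectation_mat_def P_mat_def N_mat_def)
  \<comment> \<open>Nonnegativity of \<open>phi\<close> is given only for permitted adjunctions; for
    all other elementary trees its value is 0 by convention.\<close>
  moreover have "0 \<le> ?M $$ (i, j)" if "i < ?k" "j < ?k" for i j
  proof (cases "fst (Xs ! j) \<in> Adj G (Xs ! i)")
    case True
    then show ?thesis using phi_Some_nonneg[OF node[OF that(1)]] entry[OF that] by simp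
  next
    case False
    then show ?thesis
      using phi_Some_eq_0[OF node[OF that(1)] fst_adj_node[OF node[OF that(2)]]] entry[OF that] by simp
  qed
  moreover have "0 \<le> lost_mass G n (Xs ! i)" if "i < ?k" for n i
    using lost_mass_bounds[OF node[OF that], of n] by simp
  moreover have "lost_mass G (Suc n) (Xs ! i) \<le> (\<Sum>j < ?k. ?M $$ (i, j) * lost_mass G n (Xs ! j))"
    if "i < ?k" for n i
  proof -
    have "(\<Sum>Y \<in> adj_nodes G. phi G (Xs ! i) (Some (fst Y)) * lost_mass G n Y)
        = (\<Sum>j < ?k. phi G (Xs ! i) (Some (fst (Xs ! j))) * lost_mass G n (Xs ! j))"
      using bij_betw_nth[OF \<open>distinct Xs\<close> refl Xs[symmetric]]
      by (rule sum.reindex_bij_betw[symmetric])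
    then show ?thesis
      using lost_mass_Suc_le[OF node[OF that], of n] entry[OF that] by simp
  qed
  ultimately have "(\<lambda>n. lost_mass G n (Xs ! i)) \<longlonglongrightarrow> 0"
    using subinvariant_tendsto_0[of ?M ?k "\<lambda>n i. lost_mass G n (Xs ! i)" i] rho i(1) by blast
  then show ?thesis using i by simp
qed

text \<open>The missing mass is squeezed between 0 and a finite sum of lost masses. That bound
  concerns depth \<open>Suc n\<close>, so the limit is first found for the shifted sequence.\<close>

lemma run_mass_tendsto_1:
  assumes "\<And>X. X \<in> adj_nodes G \<Longrightarrow> (\<lambda>n. lost_mass G n X) \<longlonglongrightarrow> 0" and t: "t \<in> elementary G"
  shows "(\<lambda>n. run_mass G n t) \<longlonglongrightarrow> 1"
proof -
  have "(\<lambda>n. \<Sum>p \<in> sites t. lost_mass G n (t, p)) \<longlonglongrightarrow> 0"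
    using assms(1) by (intro tendsto_null_sum) (simp add: sites_def)
  moreover have "norm (1 - run_mass G (Suc n) t) \<le> (\<Sum>p \<in> sites t. lost_mass G n (t, p))" for n
    using one_minus_run_mass_Suc_le[OF t, of n] run_mass_bounds[OF t, of "Suc n"] by simp
  ultimately have "(\<lambda>n. 1 - run_mass G (Suc n) t) \<longlonglongrightarrow> 0"
    by (rule Lim_null_comparison[OF always_eventually[OF allI], rotated])
  then have "(\<lambda>n. 1 - (1 - run_mass G (Suc n) t)) \<longlonglongrightarrow> 1 - 0"
    by (intro tendsto_intros)
  then have "(\<lambda>n. run_mass G (Suc n) t) \<longlonglongrightarrow> 1" by simp
  then show ?thesis by (rule LIMSEQ_imp_Suc)
qed

text \<open>The finite sets \<open>?A n\<close> exhaust the derivations, and their total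
  probabilities are averages of run masses with weights \<open>init_prob\<close>, hence tend to the
  sum of the weights.\<close>

lemma has_sum_deriv_prob:
  assumes "start_distribution G" and lim: "\<And>t. t \<in> elementary G \<Longrightarrow> (\<lambda>n. run_mass G n t) \<longlonglongrightarrow> 1"
  shows "(deriv_prob G has_sum 1) (derivations G)"
proof -
  let ?A = "\<lambda>n. {d. d \<in> runs_upto G n \<and> root d \<in> start_trees G}"
  have sub: "start_trees G \<subseteq> elementary G" by (auto simp: start_trees_def elementary_def)
  have "derivations G = (\<Union>n. ?A n)"
    using UN_runs_upto by (auto simp: derivations_def)
  moreover have "(deriv_prob G has_sum 1) (\<Union>n. ?A n)"
  proof (rule has_sum_UN_incseq)
    show "finite (?A n)" for n using finite_runs_upto by simp
    show "incseq ?A"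
      using incseq_SucD[OF incseq_runs_upto, of G] by (intro incseq_SucI) blast
    show "0 \<le> deriv_prob G d" if "d \<in> (\<Union>n. ?A n)" for d
      using that assms(1) run_prob_nonneg run_if_runs_upto
      by (auto simp: deriv_prob_def start_distribution_def intro!: mult_nonneg_nonneg)
    have "(\<lambda>n. \<Sum>t \<in> start_trees G. init_prob G t * run_mass G n t)
        \<longlonglongrightarrow> (\<Sum>t \<in> start_trees G. init_prob G t * 1)"
      using lim sub by (intro tendsto_sum tendsto_mult_left) auto
    moreover have "sum (deriv_prob G) (?A n) = (\<Sum>t \<in> start_trees G. init_prob G t * run_mass G n t)" for n
      unfolding deriv_prob_def by (rule sum_runs_upto[OF finite_subset[OF sub finite_elementary]])
    ultimately show "(\<lambda>n. sum (deriv_prob G) (?A n)) \<longlonglongrightarrow> 1"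
      using assms(1) by (simp add: start_distribution_def)
  qed
  ultimately show ?thesis by simp
qed

end

theorem theorem4p1:
  fixes G :: "('e, 'n, 's) ptag"
    and Xs :: "('e \<times> addr) list"
    and ts :: "'e list"
  assumes "probabilistic_tag G"
    and "lexicalized G"
    and "proper G"
    and "no_foot_adjunction G"
    and "start_distribution G"
    and "distinct Xs" and "set Xs = adj_nodes G"
    and "distinct ts" and "set ts = elementary G"
    and "rho (expectation_mat G Xs ts) < 1"
  shows "consistent G"
proof -
  \<comment> \<open>The list \<open>Xs\<close> enumerates \<open>adj_nodes G\<close>, which supplies
    the finiteness that the locale assumes.\<close>
  interpret proper_ptag G
    using assms finite_set[of Xs] by unfold_locales simp_all
  have "(deriv_prob G has_sum 1) (derivations G)"
    using assms by (intro has_sum_deriv_prob run_mass_tendsto_1 lost_mass_tendsto_0)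
  \<comment> \<open>Grouping the derivations by their yield turns the sum over derivations into one
    over strings.\<close>
  then show ?thesis
    unfolding consistent_def language_def string_prob_def by (rule has_sum_fibres)
qed

end
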